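(* Let $\alpha\vDash n$, $\beta\vDash m$ be compositions with $\beta\subseteq\alpha$. Then $\mathcal{V}_{\alpha/\beta}$ is a cyclic $H_{n-m}(0)$-module generated by the element $S^0_{\alpha/\beta}$. The same statement holds for the module $\mathcal{A}_{\alpha/\beta}$ defined by the $\mathcal{A}^*$-action on $\mathrm{SIT}(\alpha/\beta)$.
   Context: Compositions and tableaux. A composition $\alpha=(\alpha_1,\dots,\alpha_k)\vDash n$ is a finite sequence of positive integers with sum $n=|\alpha|$; $\ell(\alpha)=k$; $\emptyset$ is the empty composition of $0$. The diagram of $\alpha$ is the left-justified array of cells with $\alpha_i$ cells in row $i$, rows numbered from bottom to top. $\beta\subseteq\alpha$ means $\ell(\beta)\le\ell(\alpha)$ and $\beta_j\le\alpha_j$ for all $1\le j\le \ell(\beta)$; the skew diagram $\alpha/\beta$ is the set of cells of the diagram of $\alpha$ not in that of $\beta$, where $\beta$ is placed in the bottom-left corner of $\alpha$. $\mathrm{SIT}(\alpha/\beta)$ is the set of bijective fillings of the cells of $\alpha/\beta$ with $1,\dots,|\alpha|-|\beta|$ such that the entries in the cells of the leftmost column of $\alpha$ that are not in $\beta$ increase from bottom to top, and all rows increase from left to right. $S^0_{\alpha/\beta}\in\mathrm{SIT}(\alpha/\beta)$ is the tableau in which the cells of the first column of $\alpha$ remaining in $\alpha/\beta$ (if any) are filled with $1,\dots,\ell(\alpha)-\ell(\beta)$, increasing bottom to top, and then the remaining cells are filled by rows, top to bottom, left to right within rows, with the consecutive integers $\ell(\alpha)-\ell(\beta)+1,\dots,n-m$.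 $H_N(0)$ is the $\mathbb{C}$-algebra with generators $\pi_1,\dots,\pi_{N-1}$ and relations $\pi_i^2=\pi_i$, $\pi_i\pi_{i+1}\pi_i=\pi_{i+1}\pi_i\pi_{i+1}$, $\pi_i\pi_j=\pi_j\pi_i$ for $|i-j|\ge2$ (and $H_0(0)=H_1(0)=\mathbb{C}$). Let $s_i$ switch the entries $i,i+1$ of a tableau. Let $\mathrm{Des}_{\mathcal{R}\mathfrak{S}^*}(T)$ be the set of $i$ such that $i+1$ is in a row weakly below $i$ in $T$, and $\mathrm{Des}_{\mathcal{A}^*}(T)$ the set of $i$ such that $i+1$ is in a row strictly below $i$ in $T$. For $a\in\{\mathcal{R}\mathfrak{S}^*,\mathcal{A}^*\}$ the $a$-action of $H_{n-m}(0)$ on the complex vector space with basis $\mathrm{SIT}(\alpha/\beta)$ is: $\pi_i^a(T)=T$ if $i\notin\mathrm{Des}_a(T)$; $\pi_i^a(T)=s_i(T)$ if $i\in\mathrm{Des}_a(T)$ and $s_i(T)\in\mathrm{SIT}(\alpha/\beta)$; $\pi_i^a(T)=0$ otherwise. The resulting modules are $\mathcal{V}_{\alpha/\beta}$ (for $a=\mathcal{R}\mathfrak{S}^*$) and $\mathcal{A}_{\alpha/\beta}$ (for $a=\mathcal{A}^*$). *)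

theory Defs
  imports Complex_Main "HOL-Library.FuncSet" "HOL-Combinatorics.Transposition"
    "HOL-Algebra.QuotRing" "HOL-Algebra.Module"
begin

section \<open>Compositions and standard immaculate tableaux of skew shape\<close>

definition is_composition :: "nat list \<Rightarrow> nat \<Rightarrow> bool" where
  "is_composition \<alpha> n \<longleftrightarrow> (\<forall>a\<in>set \<alpha>. 0 < a) \<and> sum_list \<alpha> = n"

definition comp_subset :: "nat list \<Rightarrow> nat list \<Rightarrow> bool" where
  "comp_subset \<beta> \<alpha> \<longleftrightarrow> length \<beta> \<le> length \<alpha> \<and> (\<forall>j < length \<beta>. \<beta> ! j \<le> \<alpha> ! j)"

text \<open>A cell is a pair (row, column), both counted from 0; row 0 is the bottom row, so a
  larger row index means a higher row, and column 0 is the leftmost column.\<close>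

type_synonym cell = "nat \<times> nat"
type_synonym tableau = "cell \<Rightarrow> nat"

definition diagram :: "nat list \<Rightarrow> cell set" where
  "diagram \<alpha> = {(r, c). r < length \<alpha> \<and> c < \<alpha> ! r}"

definition skew :: "nat list \<Rightarrow> nat list \<Rightarrow> cell set" where
  "skew \<alpha> \<beta> = diagram \<alpha> - diagram \<beta>"

text \<open>Fillings are made canonical by taking the value \<open>undefined\<close> outside the diagram.\<close>

definition SIT :: "nat list \<Rightarrow> nat list \<Rightarrow> tableau set" where
  "SIT \<alpha> \<beta> = {T \<in> extensional (skew \<alpha> \<beta>).
     bij_betw T (skew \<alpha> \<beta>) {1..sum_list \<alpha> - sum_list \<beta>} \<and>
     (\<forall>r r'. (r, 0) \<in> skew \<alpha> \<beta> \<and> (r', 0) \<in> skew \<alpha> \<beta> \<and> r < r' \<longrightarrow> T (r, 0) < T (r', 0)) \<and>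
     (\<forall>r c c'. (r, c) \<in> skew \<alpha> \<beta> \<and> (r, c') \<in> skew \<alpha> \<beta> \<and> c < c' \<longrightarrow> T (r, c) < T (r, c'))}"

text \<open>In \<open>S0\<close>, a cell outside the first column receives \<open>length \<alpha> - length \<beta>\<close> plus its
  position in the reading order (rows top to bottom, left to right within a row) of the cells
  outside the first column.\<close>

definition S0 :: "nat list \<Rightarrow> nat list \<Rightarrow> tableau" where
  "S0 \<alpha> \<beta> = (\<lambda>(r, c) \<in> skew \<alpha> \<beta>.
     if c = 0 then r - length \<beta> + 1
     else length \<alpha> - length \<beta> +
       card {(r', c') \<in> skew \<alpha> \<beta>. c' \<noteq> 0 \<and> (r < r' \<or> r' = r \<and> c' \<le> c)})"

definition switch :: "nat list \<Rightarrow> nat list \<Rightarrow> nat \<Rightarrow> tableau \<Rightarrow> tableau" where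
  "switch \<alpha> \<beta> i T = (\<lambda>x \<in> skew \<alpha> \<beta>. Transposition.transpose i (Suc i) (T x))"

definition Des_RS :: "nat list \<Rightarrow> nat list \<Rightarrow> tableau \<Rightarrow> nat set" where
  "Des_RS \<alpha> \<beta> T = {i. \<exists>r c r' c'. (r, c) \<in> skew \<alpha> \<beta> \<and> (r', c') \<in> skew \<alpha> \<beta> \<and>
     T (r, c) = i \<and> T (r', c') = Suc i \<and> r' \<le> r}"

definition Des_A :: "nat list \<Rightarrow> nat list \<Rightarrow> tableau \<Rightarrow> nat set" where
  "Des_A \<alpha> \<beta> T = {i. \<exists>r c r' c'. (r, c) \<in> skew \<alpha> \<beta> \<and> (r', c') \<in> skew \<alpha> \<beta> \<and>
     T (r, c) = i \<and> T (r', c') = Suc i \<and> r' < r}"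

section \<open>The 0-Hecke algebra\<close>

text \<open>The free complex algebra on noncommuting letters \<open>1, ..., N - 1\<close>: finitely supported
  complex functions on words, with the concatenation (Cauchy) product.\<close>

definition free_alg :: "nat \<Rightarrow> (nat list \<Rightarrow> complex) ring" where
  "free_alg N = \<lparr>
     carrier = {p. finite {w. p w \<noteq> 0} \<and> (\<forall>w. p w \<noteq> 0 \<longrightarrow> set w \<subseteq> {1..<N})},
     mult = (\<lambda>p q w. \<Sum>k\<le>length w. p (take k w) * q (drop k w)),
     one = (\<lambda>w. if w = [] then 1 else 0),
     zero = (\<lambda>w. 0),
     add = (\<lambda>p q w. p w + q w)\<rparr>"

definition letter :: "nat \<Rightarrow> nat list \<Rightarrow> complex" where
  "letter i = (\<lambda>w. if w = [i] then 1 else 0)"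

definition hecke_rels :: "nat \<Rightarrow> (nat list \<Rightarrow> complex) set" where
  "hecke_rels N = (let F = free_alg N; \<pi> = letter in
     {\<pi> i \<otimes>\<^bsub>F\<^esub> \<pi> i \<ominus>\<^bsub>F\<^esub> \<pi> i | i. i \<in> {1..<N}} \<union>
     {\<pi> i \<otimes>\<^bsub>F\<^esub> \<pi> (Suc i) \<otimes>\<^bsub>F\<^esub> \<pi> i \<ominus>\<^bsub>F\<^esub> \<pi> (Suc i) \<otimes>\<^bsub>F\<^esub> \<pi> i \<otimes>\<^bsub>F\<^esub> \<pi> (Suc i) | i.
        i \<in> {1..<N} \<and> Suc i \<in> {1..<N}} \<union>
     {\<pi> i \<otimes>\<^bsub>F\<^esub> \<pi> j \<ominus>\<^bsub>F\<^esub> \<pi> j \<otimes>\<^bsub>F\<^esub> \<pi> i | i j.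
        i \<in> {1..<N} \<and> j \<in> {1..<N} \<and> 2 \<le> \<bar>int i - int j\<bar>})"

text \<open>\<open>Idl\<close> is the generated two-sided ideal, so this is the algebra given by the usual
  presentation. Elements are cosets of the free algebra; the scalars are the classes of the
  constants (multiples of the empty word).\<close>

definition hecke0 :: "nat \<Rightarrow> (nat list \<Rightarrow> complex) set ring" where
  "hecke0 N = free_alg N Quot (Idl\<^bsub>free_alg N\<^esub> (hecke_rels N))"

section \<open>Modules over noncommutative rings\<close>

text \<open>The library locale \<open>module\<close> requires a commutative ring of scalars; we keep its record
  type and its axioms.\<close>

locale left_module = R?: ring R + M?: abelian_group M
  for R :: "('a, 'c) ring_scheme" (structure) and M :: "('a, 'b, 'd) module_scheme" (structure) +
  assumes smult_closed:
      "\<lbrakk>a \<in> carrier R; x \<in> carrier M\<rbrakk> \<Longrightarrow> a \<odot>\<^bsub>M\<^esub> x \<in> carrier M"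
    and smult_l_distr:
      "\<lbrakk>a \<in> carrier R; b \<in> carrier R; x \<in> carrier M\<rbrakk> \<Longrightarrow>
       (a \<oplus>\<^bsub>R\<^esub> b) \<odot>\<^bsub>M\<^esub> x = a \<odot>\<^bsub>M\<^esub> x \<oplus>\<^bsub>M\<^esub> b \<odot>\<^bsub>M\<^esub> x"
    and smult_r_distr:
      "\<lbrakk>a \<in> carrier R; x \<in> carrier M; y \<in> carrier M\<rbrakk> \<Longrightarrow>
       a \<odot>\<^bsub>M\<^esub> (x \<oplus>\<^bsub>M\<^esub> y) = a \<odot>\<^bsub>M\<^esub> x \<oplus>\<^bsub>M\<^esub> a \<odot>\<^bsub>M\<^esub> y"
    and smult_assoc:
      "\<lbrakk>a \<in> carrier R; b \<in> carrier R; x \<in> carrier M\<rbrakk> \<Longrightarrow>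
       (a \<otimes>\<^bsub>R\<^esub> b) \<odot>\<^bsub>M\<^esub> x = a \<odot>\<^bsub>M\<^esub> (b \<odot>\<^bsub>M\<^esub> x)"
    and smult_one:
      "x \<in> carrier M \<Longrightarrow> \<one>\<^bsub>R\<^esub> \<odot>\<^bsub>M\<^esub> x = x"

definition cyclic_module_generated_by ::
  "('a, 'c) ring_scheme \<Rightarrow> ('a, 'b, 'd) module_scheme \<Rightarrow> 'b \<Rightarrow> bool" where
  "cyclic_module_generated_by R M x \<longleftrightarrow>
     left_module R M \<and> x \<in> carrier M \<and> carrier M = {a \<odot>\<^bsub>M\<^esub> x | a. a \<in> carrier R}"

section \<open>The modules spanned by tableaux\<close>

text \<open>Vectors are complex functions on tableaux that vanish outside \<open>SIT \<alpha> \<beta>\<close>;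
  \<open>tvec T\<close> is the basis vector belonging to \<open>T\<close>. The argument \<open>D\<close> is the descent function
  (\<open>Des_RS \<alpha> \<beta>\<close> or \<open>Des_A \<alpha> \<beta>\<close>) that selects the action.\<close>

type_synonym tvector = "tableau \<Rightarrow> complex"

definition tvec :: "tableau \<Rightarrow> tvector" where
  "tvec T = (\<lambda>U. if U = T then 1 else 0)"

definition pi_basis ::
  "(tableau \<Rightarrow> nat set) \<Rightarrow> nat list \<Rightarrow> nat list \<Rightarrow> nat \<Rightarrow> tableau \<Rightarrow> tvector" where
  "pi_basis D \<alpha> \<beta> i T =
     (if i \<notin> D T then tvec T
      else if switch \<alpha> \<beta> i T \<in> SIT \<alpha> \<beta> then tvec (switch \<alpha> \<beta> i T)
      else (\<lambda>U. 0))"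

definition pi_op ::
  "(tableau \<Rightarrow> nat set) \<Rightarrow> nat list \<Rightarrow> nat list \<Rightarrow> nat \<Rightarrow> tvector \<Rightarrow> tvector" where
  "pi_op D \<alpha> \<beta> i v = (\<lambda>U. \<Sum>T\<in>SIT \<alpha> \<beta>. v T * pi_basis D \<alpha> \<beta> i T U)"

text \<open>The word \<open>[i, j, ...]\<close> stands for the product of the generators \<open>i, j, ...\<close>, so its last
  letter acts first.\<close>

definition free_act ::
  "(tableau \<Rightarrow> nat set) \<Rightarrow> nat list \<Rightarrow> nat list \<Rightarrow> (nat list \<Rightarrow> complex) \<Rightarrow> tvector \<Rightarrow> tvector" where
  "free_act D \<alpha> \<beta> p v = (\<lambda>U. \<Sum>w | p w \<noteq> 0. p w * foldr (pi_op D \<alpha> \<beta>) w v U)"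

text \<open>A coset acts by the common value of its representatives. All representatives agree
  because the defining relations hold for the operators \<open>pi_op\<close>. The fields \<open>mult\<close> and \<open>one\<close> of
  the record play no role in a module.\<close>

definition tableau_module ::
  "(tableau \<Rightarrow> nat set) \<Rightarrow> nat list \<Rightarrow> nat list \<Rightarrow> ((nat list \<Rightarrow> complex) set, tvector) module" where
  "tableau_module D \<alpha> \<beta> = \<lparr>
     carrier = {v. \<forall>T. T \<notin> SIT \<alpha> \<beta> \<longrightarrow> v T = 0},
     mult = undefined,
     one = undefined,
     zero = (\<lambda>T. 0),
     add = (\<lambda>u v T. u T + v T),
     smult = (\<lambda>X v. the_elem ((\<lambda>p. free_act D \<alpha> \<beta> p v) ` X))\<rparr>"

definition V_module ::
  "nat list \<Rightarrow> nat list \<Rightarrow> ((nat list \<Rightarrow> complex) set, tvector) module" where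
  "V_module \<alpha> \<beta> = tableau_module (Des_RS \<alpha> \<beta>) \<alpha> \<beta>"

definition A_module ::
  "nat list \<Rightarrow> nat list \<Rightarrow> ((nat list \<Rightarrow> complex) set, tvector) module" where
  "A_module \<alpha> \<beta> = tableau_module (Des_A \<alpha> \<beta>) \<alpha> \<beta>"

end

theory Submission
  imports Defs
begin

text \<open>A standard immaculate tableau is a linear extension of a partial order on the cells, and
  \<open>S0\<close> is the linear extension given by a total reading order. If \<open>T\<close> is not \<open>S0\<close>, then two
  consecutive entries \<open>i\<close>, \<open>i + 1\<close> of \<open>T\<close> violate the reading order, and this forces \<open>i + 1\<close> into a
  strictly higher row than \<open>i\<close>. Exchanging them gives a tableau from which the generator \<open>i\<close>
  leads back to \<open>T\<close>, and lowers the sum of entry times row number, so \<open>T\<close> is reached from \<open>S0\<close>.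
  The 0-Hecke relations depend only on the rows of the entries involved, where the operators are
  bubble sorts. Hence the free algebra acts with the defining relations in the annihilator, which
  is a two-sided ideal, and the action descends to the quotient.\<close>

section \<open>The free algebra\<close>

lemma free_alg_simps:
  "p \<in> carrier (free_alg N) \<longleftrightarrow> finite {w. p w \<noteq> 0} \<and> (\<forall>w. p w \<noteq> 0 \<longrightarrow> set w \<subseteq> {1..<N})"
  "p \<otimes>\<^bsub>free_alg N\<^esub> q = (\<lambda>w. \<Sum>k\<le>length w. p (take k w) * q (drop k w))"
  "\<one>\<^bsub>free_alg N\<^esub> = (\<lambda>w. if w = [] then 1 else 0)"
  "\<zero>\<^bsub>free_alg N\<^esub> = (\<lambda>w. 0)"
  "p \<oplus>\<^bsub>free_alg N\<^esub> q = (\<lambda>w. p w + q w)"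
  by (auto simp: free_alg_def)

text \<open>Cutting \<open>w\<close> at each position \<open>k\<close> lists every factorisation
  \<open>u @ v = w\<close> exactly once, and pairs outside the supports contribute zero. The Cauchy
  product thus becomes a sum over a fibre of concatenation.\<close>

lemma free_mult_eq_fibre_sum:
  fixes p q :: "nat list \<Rightarrow> complex"
  assumes "finite {w. p w \<noteq> 0}" and "finite {w. q w \<noteq> 0}"
  shows "(\<Sum>k\<le>length w. p (take k w) * q (drop k w)) =
    (\<Sum>x\<in>{x \<in> {u. p u \<noteq> 0} \<times> {v. q v \<noteq> 0}. fst x @ snd x = w}. p (fst x) * q (snd x))"
proof -
  have inj: "inj_on (\<lambda>k. (take k w, drop k w)) {..length w}"
    by (rule inj_onI) (metis atMost_iff length_take min.absorb2 prod.inject)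
  have img: "(\<lambda>k. (take k w, drop k w)) ` {..length w} = {x. fst x @ snd x = w}"
  proof (intro equalityI subsetI)
    fix x assume "x \<in> {x. fst x @ snd x = w}"
    then show "x \<in> (\<lambda>k. (take k w, drop k w)) ` {..length w}"
      by (intro image_eqI[of _ _ "length (fst x)"]) auto
  next
    fix x assume "x \<in> (\<lambda>k. (take k w, drop k w)) ` {..length w}"
    then show "x \<in> {x. fst x @ snd x = w}"
      by auto
  qed
  have "(\<Sum>k\<le>length w. p (take k w) * q (drop k w)) =
      (\<Sum>x\<in>{x. fst x @ snd x = w}. p (fst x) * q (snd x))"
    unfolding img[symmetric] sum.reindex[OF inj] by simp
  also have "\<dots> = (\<Sum>x\<in>{x \<in> {u. p u \<noteq> 0} \<times> {v. q v \<noteq> 0}. fst x @ snd x = w}.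
      p (fst x) * q (snd x))"
  proof (rule sum.mono_neutral_right)
    show "finite {x. fst x @ snd x = w}"
      unfolding img[symmetric] by simp
    show "\<forall>x\<in>{x. fst x @ snd x = w} - {x \<in> {u. p u \<noteq> 0} \<times> {v. q v \<noteq> 0}. fst x @ snd x = w}.
        p (fst x) * q (snd x) = 0"
      by (auto simp: mem_Times_iff)
  qed (rule Collect_mono, blast)
  finally show ?thesis .
qed

lemma free_mult_support:
  fixes p q :: "nat list \<Rightarrow> complex"
  shows "{w. (\<Sum>k\<le>length w. p (take k w) * q (drop k w)) \<noteq> 0}
    \<subseteq> (\<lambda>x. fst x @ snd x) ` ({u. p u \<noteq> 0} \<times> {v. q v \<noteq> 0})"
proof
  fix w assume "w \<in> {w. (\<Sum>k\<le>length w. p (take k w) * q (drop k w)) \<noteq> 0}"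
  then obtain k where "p (take k w) * q (drop k w) \<noteq> 0"
    by (metis (mono_tags, lifting) mem_Collect_eq sum.neutral)
  then show "w \<in> (\<lambda>x. fst x @ snd x) ` ({u. p u \<noteq> 0} \<times> {v. q v \<noteq> 0})"
    by (intro image_eqI[of _ _ "(take k w, drop k w)"]) auto
qed

text \<open>Grouping pairs of words by their concatenation evaluates a product against any
  \<open>f\<close>. With \<open>f w\<close> the value of the word \<open>w\<close> on a vector, this
  makes the action multiplicative.\<close>

lemma free_mult_sum:
  fixes p q f :: "nat list \<Rightarrow> complex"
  assumes "finite {w. p w \<noteq> 0}" and "finite {w. q w \<noteq> 0}"
  defines "pq \<equiv> (\<lambda>w. \<Sum>k\<le>length w. p (take k w) * q (drop k w))"
  shows "(\<Sum>w | pq w \<noteq> 0. pq w * f w) = (\<Sum>u | p u \<noteq> 0. \<Sum>v | q v \<noteq> 0. p u * (q v * f (u @ v)))"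
proof -
  let ?PQ = "{u. p u \<noteq> 0} \<times> {v. q v \<noteq> 0}"
  let ?W = "(\<lambda>x. fst x @ snd x) ` ?PQ"
  have fin: "finite ?PQ"
    using assms by blast
  \<comment> \<open>Coefficients may cancel, so the support of \<open>pq\<close> can be smaller than
    the set of concatenations; the additional terms are zero.\<close>
  have "(\<Sum>w | pq w \<noteq> 0. pq w * f w) = (\<Sum>w\<in>?W. pq w * f w)"
    using fin free_mult_support[of p q] by (intro sum.mono_neutral_left) (auto simp: pq_def)
  also have "\<dots> = (\<Sum>w\<in>?W. \<Sum>x\<in>{x \<in> ?PQ. fst x @ snd x = w}. p (fst x) * (q (snd x) * f (fst x @ snd x)))"
  proof (rule sum.cong[OF refl])
    fix w assume "w \<in> ?W"
    have "pq w * f w = (\<Sum>x\<in>{x \<in> ?PQ. fst x @ snd x = w}. p (fst x) * q (snd x) * f w)"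
      unfolding pq_def free_mult_eq_fibre_sum[OF assms(1,2)] by (rule sum_distrib_right)
    also have "\<dots> = (\<Sum>x\<in>{x \<in> ?PQ. fst x @ snd x = w}. p (fst x) * (q (snd x) * f (fst x @ snd x)))"
      by (rule sum.cong) auto
    finally show "pq w * f w = \<dots>" .
  qed
  also have "\<dots> = (\<Sum>x\<in>?PQ. p (fst x) * (q (snd x) * f (fst x @ snd x)))"
    by (rule sum.image_gen[OF fin, symmetric])
  also have "\<dots> = (\<Sum>u | p u \<noteq> 0. \<Sum>v | q v \<noteq> 0. p u * (q v * f (u @ v)))"
    by (simp add: sum.cartesian_product case_prod_beta)
  finally show ?thesis .
qed

lemma free_mult_closed:
  assumes "p \<in> carrier (free_alg N)" and "q \<in> carrier (free_alg N)"
  shows "p \<otimes>\<^bsub>free_alg N\<^esub> q \<in> carrier (free_alg N)"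
proof -
  let ?pq = "\<lambda>w. \<Sum>k\<le>length w. p (take k w) * q (drop k w)"
  have "finite {w. ?pq w \<noteq> 0}"
    by (rule finite_subset[OF free_mult_support]) (use assms in \<open>simp add: free_alg_simps\<close>)
  moreover have "set w \<subseteq> {1..<N}" if w: "?pq w \<noteq> 0" for w
  proof -
    obtain u v where "p u \<noteq> 0" "q v \<noteq> 0" "w = u @ v"
      using w free_mult_support[of p q] by force
    then show ?thesis
      using assms by (auto simp: free_alg_simps)
  qed
  ultimately show ?thesis
    unfolding free_alg_simps by blast
qed

text \<open>Both sides sum over two cuts \<open>j \<le> k\<close> of \<open>w\<close> into three
  pieces. The left side chooses the later cut first, the right side the earlier one; there the later
  cut is measured inside \<open>drop j w\<close>, at \<open>l = k - j\<close>.\<close>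

lemma free_mult_assoc:
  fixes p q r :: "nat list \<Rightarrow> complex"
  shows "(p \<otimes>\<^bsub>free_alg N\<^esub> q) \<otimes>\<^bsub>free_alg N\<^esub> r = p \<otimes>\<^bsub>free_alg N\<^esub> (q \<otimes>\<^bsub>free_alg N\<^esub> r)"
proof
  fix w :: "nat list"
  let ?g = "\<lambda>j k. p (take j w) * q (drop j (take k w)) * r (drop k w)"
  have "((p \<otimes>\<^bsub>free_alg N\<^esub> q) \<otimes>\<^bsub>free_alg N\<^esub> r) w = (\<Sum>k\<le>length w. \<Sum>j\<le>k. ?g j k)"
    by (auto simp: free_alg_simps sum_distrib_right min_def intro!: sum.cong)
  also have "\<dots> = (\<Sum>j\<le>length w. \<Sum>k\<in>{j..length w}. ?g j k)"
    by (subst sum.Sigma, simp, simp, subst sum.Sigma, simp, simp,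
        rule sum.reindex_bij_witness[of _ "\<lambda>(j, k). (k, j)" "\<lambda>(k, j). (j, k)"]) auto
  also have "\<dots> = (\<Sum>j\<le>length w. \<Sum>l\<le>length w - j. ?g j (j + l))"
  proof (rule sum.cong[OF refl])
    fix j assume "j \<in> {..length w}"
    then show "(\<Sum>k\<in>{j..length w}. ?g j k) = (\<Sum>l\<le>length w - j. ?g j (j + l))"
      by (intro sum.reindex_bij_witness[of _ "\<lambda>l. j + l" "\<lambda>k. k - j"]) auto
  qed
  also have "\<dots> = (p \<otimes>\<^bsub>free_alg N\<^esub> (q \<otimes>\<^bsub>free_alg N\<^esub> r)) w"
    by (auto simp: free_alg_simps sum_distrib_left drop_take mult.assoc add.commute intro!: sum.cong)
  finally show "((p \<otimes>\<^bsub>free_alg N\<^esub> q) \<otimes>\<^bsub>free_alg N\<^esub> r) w = \<dots>" .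
qed

lemma free_add_closed:
  assumes "p \<in> carrier (free_alg N)" and "q \<in> carrier (free_alg N)"
  shows "p \<oplus>\<^bsub>free_alg N\<^esub> q \<in> carrier (free_alg N)"
proof -
  have "{w. p w + q w \<noteq> 0} \<subseteq> {w. p w \<noteq> 0} \<union> {w. q w \<noteq> 0}"
    by auto
  then have "finite {w. p w + q w \<noteq> 0}"
    by (rule finite_subset) (use assms in \<open>simp add: free_alg_simps\<close>)
  moreover have "set w \<subseteq> {1..<N}" if "p w + q w \<noteq> 0" for w
  proof -
    have "p w \<noteq> 0 \<or> q w \<noteq> 0"
      using that by auto
    then show ?thesis
      using assms unfolding free_alg_simps by blast
  qed
  ultimately show ?thesis
    unfolding free_alg_simps by blast
qed

lemma ring_free_alg: "ring (free_alg N)"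
proof (rule ringI)
  show "abelian_group (free_alg N)"
  proof (rule abelian_groupI)
    fix p assume p: "p \<in> carrier (free_alg N)"
    then show "\<exists>q\<in>carrier (free_alg N). q \<oplus>\<^bsub>free_alg N\<^esub> p = \<zero>\<^bsub>free_alg N\<^esub>"
      by (intro bexI[of _ "\<lambda>w. - p w"]) (auto simp: free_alg_simps)
  next
    show "\<zero>\<^bsub>free_alg N\<^esub> \<in> carrier (free_alg N)"
      by (simp add: free_alg_simps)
  qed (simp_all add: free_add_closed, simp_all add: free_alg_simps(4,5) add_ac)
  show "monoid (free_alg N)"
  proof (rule monoidI)
    fix p assume "p \<in> carrier (free_alg N)"
    have "(\<Sum>k\<le>length w. (if take k w = [] then 1 else 0) * p (drop k w)) = p w" for w
    proof -
      have "(\<Sum>k\<le>length w. (if take k w = [] then 1 else 0) * p (drop k w)) =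
          (\<Sum>k\<le>length w. if k = 0 then p w else 0)"
        by (rule sum.cong) auto
      then show ?thesis by simp
    qed
    then show "\<one>\<^bsub>free_alg N\<^esub> \<otimes>\<^bsub>free_alg N\<^esub> p = p"
      by (simp add: free_alg_simps)
    have "(\<Sum>k\<le>length w. p (take k w) * (if drop k w = [] then 1 else 0)) = p w" for w
    proof -
      have "(\<Sum>k\<le>length w. p (take k w) * (if drop k w = [] then 1 else 0)) =
          (\<Sum>k\<le>length w. if k = length w then p w else 0)"
        by (rule sum.cong) auto
      then show ?thesis by simp
    qed
    then show "p \<otimes>\<^bsub>free_alg N\<^esub> \<one>\<^bsub>free_alg N\<^esub> = p"
      by (simp add: free_alg_simps)
  next
    show "\<one>\<^bsub>free_alg N\<^esub> \<in> carrier (free_alg N)"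
      by (simp add: free_alg_simps)
  qed (simp_all only: free_mult_closed free_mult_assoc)
  fix p q r :: "nat list \<Rightarrow> complex"
  show "(p \<oplus>\<^bsub>free_alg N\<^esub> q) \<otimes>\<^bsub>free_alg N\<^esub> r = p \<otimes>\<^bsub>free_alg N\<^esub> r \<oplus>\<^bsub>free_alg N\<^esub> q \<otimes>\<^bsub>free_alg N\<^esub> r"
    by (simp add: free_alg_simps(2,5) distrib_right sum.distrib)
  show "r \<otimes>\<^bsub>free_alg N\<^esub> (p \<oplus>\<^bsub>free_alg N\<^esub> q) = r \<otimes>\<^bsub>free_alg N\<^esub> p \<oplus>\<^bsub>free_alg N\<^esub> r \<otimes>\<^bsub>free_alg N\<^esub> q"
    by (simp add: free_alg_simps(2,5) distrib_left sum.distrib)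
qed

lemma free_uminus:
  assumes "p \<in> carrier (free_alg N)"
  shows "\<ominus>\<^bsub>free_alg N\<^esub> p = (\<lambda>w. - p w)"
proof -
  interpret ring "free_alg N" by (rule ring_free_alg)
  show ?thesis
    by (rule minus_equality) (use assms in \<open>auto simp: free_alg_simps\<close>)
qed

lemma letter_closed: "i \<in> {1..<N} \<Longrightarrow> letter i \<in> carrier (free_alg N)"
proof -
  assume "i \<in> {1..<N}"
  moreover have "{w. letter i w \<noteq> 0} = {[i]}"
    by (auto simp: letter_def)
  ultimately show ?thesis
    unfolding free_alg_simps(1) by (auto simp: letter_def)
qed

lemma hecke_rels_closed: "hecke_rels N \<subseteq> carrier (free_alg N)"
proof -
  interpret ring "free_alg N" by (rule ring_free_alg)
  show ?thesis
    by (auto simp: hecke_rels_def Let_def letter_closed)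
qed

section \<open>Ranks in a finite total order\<close>

text \<open>Transitivity and antisymmetry turn a comparison of distinct elements into a strict
  inclusion of lower sets, so ranks increase strictly. By totality the rank is injective, and an
  injection of \<open>A\<close> into \<open>{1..card A}\<close> is onto.\<close>

lemma
  fixes le :: "'a \<Rightarrow> 'a \<Rightarrow> bool"
  assumes fin: "finite A"
    and refl: "\<And>x. x \<in> A \<Longrightarrow> le x x"
    and trans: "\<And>x y z. le x y \<Longrightarrow> le y z \<Longrightarrow> le x z"
    and antisym: "\<And>x y. le x y \<Longrightarrow> le y x \<Longrightarrow> x = y"
    and total: "\<And>x y. x \<in> A \<Longrightarrow> y \<in> A \<Longrightarrow> le x y \<or> le y x"
  shows rank_less: "\<And>x y. x \<in> A \<Longrightarrow> y \<in> A \<Longrightarrow> le x y \<Longrightarrow> x \<noteq> y \<Longrightarrow>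
      card {u \<in> A. le u x} < card {u \<in> A. le u y}"
    and bij_betw_rank: "bij_betw (\<lambda>x. card {u \<in> A. le u x}) A {1..card A}"
proof -
  show less: "card {u \<in> A. le u x} < card {u \<in> A. le u y}"
    if "x \<in> A" "y \<in> A" "le x y" "x \<noteq> y" for x y
  proof (rule psubset_card_mono)
    show "{u \<in> A. le u x} \<subset> {u \<in> A. le u y}"
      using that trans antisym refl by blast
  qed (use fin in simp)
  let ?f = "\<lambda>x. card {u \<in> A. le u x}"
  have inj: "inj_on ?f A"
    by (rule inj_onI) (metis less less_irrefl total)
  have "?f ` A \<subseteq> {1..card A}"
  proof
    fix k assume "k \<in> ?f ` A"
    then obtain x where x: "x \<in> A" "k = ?f x"
      by blast
    have "0 < ?f x"
      using fin refl x(1) by (auto simp: card_gt_0_iff)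
    moreover have "?f x \<le> card A"
      using fin by (intro card_mono) auto
    ultimately show "k \<in> {1..card A}"
      using x(2) by simp
  qed
  then have "?f ` A = {1..card A}"
    by (rule card_subset_eq[rotated]) (simp_all add: card_image[OF inj])
  then show "bij_betw ?f A {1..card A}"
    using inj by (simp add: bij_betw_def)
qed

section \<open>Standard immaculate tableaux as linear extensions\<close>

text \<open>Only the comparisons imposed by \<open>SIT\<close> are listed. The relation is not
  transitive: a first-column cell precedes the start of a higher row, but not the rest of that
  row.\<close>

definition cell_prec :: "cell \<Rightarrow> cell \<Rightarrow> bool" where
  "cell_prec x y \<longleftrightarrow> snd x = 0 \<and> snd y = 0 \<and> fst x < fst y \<or> fst x = fst y \<and> snd x < snd y"

text \<open>The order in which \<open>S0\<close> numbers the cells. Being total and an extension of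
  \<open>cell_prec\<close>, it makes \<open>S0\<close> a rank function and hence a tableau.\<close>

definition reading_le :: "cell \<Rightarrow> cell \<Rightarrow> bool" where
  "reading_le x y \<longleftrightarrow>
     (if snd y = 0 then snd x = 0 \<and> fst x \<le> fst y
      else snd x = 0 \<or> fst y < fst x \<or> fst x = fst y \<and> snd x \<le> snd y)"

lemma reading_le_refl: "reading_le x x"
  by (simp add: reading_le_def)

lemma reading_le_trans: "reading_le x y \<Longrightarrow> reading_le y z \<Longrightarrow> reading_le x z"
  by (auto simp: reading_le_def split: if_splits)

lemma reading_le_antisym: "reading_le x y \<Longrightarrow> reading_le y x \<Longrightarrow> x = y"
  by (auto simp: reading_le_def prod_eq_iff split: if_splits)

lemma reading_le_total: "reading_le x y \<or> reading_le y x"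
  by (auto simp: reading_le_def)

lemma cell_prec_reading_le: "cell_prec x y \<Longrightarrow> reading_le x y \<and> x \<noteq> y"
  by (auto simp: reading_le_def cell_prec_def)

lemma SIT_iff:
  "T \<in> SIT \<alpha> \<beta> \<longleftrightarrow> T \<in> extensional (skew \<alpha> \<beta>) \<and>
     bij_betw T (skew \<alpha> \<beta>) {1..sum_list \<alpha> - sum_list \<beta>} \<and>
     (\<forall>x\<in>skew \<alpha> \<beta>. \<forall>y\<in>skew \<alpha> \<beta>. cell_prec x y \<longrightarrow> T x < T y)"
  unfolding SIT_def cell_prec_def by auto

lemma finite_diagram: "finite (diagram \<alpha>)"
  and card_diagram: "card (diagram \<alpha>) = sum_list \<alpha>"
proof -
  have eq: "diagram \<alpha> = (SIGMA r:{..<length \<alpha>}. {..<\<alpha> ! r})"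
    by (auto simp: diagram_def)
  show "finite (diagram \<alpha>)"
    by (simp add: eq)
  show "card (diagram \<alpha>) = sum_list \<alpha>"
    by (simp add: eq sum_list_sum_nth atLeast0LessThan)
qed

lemma finite_skew: "finite (skew \<alpha> \<beta>)"
  by (simp add: skew_def finite_diagram)

lemma finite_SIT: "finite (SIT \<alpha> \<beta>)"
proof (rule finite_subset)
  show "SIT \<alpha> \<beta> \<subseteq> skew \<alpha> \<beta> \<rightarrow>\<^sub>E {1..sum_list \<alpha> - sum_list \<beta>}"
    by (intro subsetI) (simp add: SIT_iff PiE_def bij_betw_imp_funcset)
qed (simp add: finite_PiE finite_skew)

section \<open>Skew diagrams, and \<open>S0\<close> as the rank function of the reading
  order\<close>

locale skew_shape =
  fixes \<alpha> \<beta> :: "nat list"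
  assumes pos_outer: "\<And>a. a \<in> set \<alpha> \<Longrightarrow> 0 < a"
    and pos_inner: "\<And>a. a \<in> set \<beta> \<Longrightarrow> 0 < a"
    and comp_subset: "comp_subset \<beta> \<alpha>"
begin

abbreviation "Y \<equiv> skew \<alpha> \<beta>"
abbreviation "N \<equiv> sum_list \<alpha> - sum_list \<beta>"

lemma card_skew: "card Y = N"
proof -
  have "diagram \<beta> \<subseteq> diagram \<alpha>"
    using comp_subset by (fastforce simp: comp_subset_def diagram_def)
  then show ?thesis
    by (simp add: skew_def card_Diff_subset finite_diagram card_diagram)
qed

text \<open>Since all parts are positive, every row of \<open>\<alpha>\<close> has a cell in column
  0 and every row of \<open>\<beta>\<close> removes that cell.\<close>

lemma first_column_iff: "(r, 0) \<in> Y \<longleftrightarrow> length \<beta> \<le> r \<and> r < length \<alpha>"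
proof -
  have "r < length \<alpha> \<Longrightarrow> 0 < \<alpha> ! r" and "r < length \<beta> \<Longrightarrow> 0 < \<beta> ! r"
    by (simp_all add: pos_outer pos_inner)
  then show ?thesis
    by (cases "r < length \<beta>") (auto simp: skew_def diagram_def)
qed

lemma row_start:
  assumes "x \<in> Y" and "length \<beta> \<le> fst x"
  shows "(fst x, 0) \<in> Y"
  using assms by (auto simp: first_column_iff) (auto simp: skew_def diagram_def)

lemma SIT_inj: "T \<in> SIT \<alpha> \<beta> \<Longrightarrow> x \<in> Y \<Longrightarrow> y \<in> Y \<Longrightarrow> T x = T y \<Longrightarrow> x = y"
  by (auto simp: SIT_iff bij_betw_def inj_on_def)

lemma SIT_less: "T \<in> SIT \<alpha> \<beta> \<Longrightarrow> x \<in> Y \<Longrightarrow> y \<in> Y \<Longrightarrow> cell_prec x y \<Longrightarrow> T x < T y"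
  by (auto simp: SIT_iff)

lemma SIT_range: "T \<in> SIT \<alpha> \<beta> \<Longrightarrow> x \<in> Y \<Longrightarrow> T x \<in> {1..N}"
  by (auto simp: SIT_iff dest: bij_betwE)

lemma SIT_cell:
  assumes "T \<in> SIT \<alpha> \<beta>" and "j \<in> {1..N}"
  obtains x where "x \<in> Y" "T x = j"
proof -
  have "j \<in> T ` Y"
    using assms by (simp add: SIT_iff bij_betw_def)
  then show ?thesis
    using that by blast
qed

text \<open>The predecessors of a first-column cell are the remaining first-column cells up to its
  row. For any other cell they are the whole remaining first column together with the set counted in
  \<open>S0\<close>, which accounts for the two summands there.\<close>

lemma S0_eq_rank:
  assumes "x \<in> Y"
  shows "S0 \<alpha> \<beta> x = card {y \<in> Y. reading_le y x}"
proof (cases x)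
  case (Pair r c)
  show ?thesis
  proof (cases "c = 0")
    case True
    have "{y \<in> Y. reading_le y x} = (\<lambda>r'. (r', 0)) ` {length \<beta>..r}"
      using assms Pair True
      by (auto simp: reading_le_def first_column_iff image_iff)
    then have "card {y \<in> Y. reading_le y x} = Suc r - length \<beta>"
      by (simp add: card_image inj_on_def)
    \<comment> \<open>Here \<open>length \<beta> \<le> r\<close>, so the truncated difference
      \<open>Suc r - length \<beta>\<close> equals \<open>r - length \<beta> + 1\<close>.\<close>
    then show ?thesis
      using assms Pair True by (auto simp: S0_def first_column_iff)
  next
    case False
    let ?A = "(\<lambda>r'. (r', 0 :: nat)) ` {length \<beta>..<length \<alpha>}"
    let ?B = "{(r', c') \<in> Y. c' \<noteq> 0 \<and> (r < r' \<or> r' = r \<and> c' \<le> c)}"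
    have "{y \<in> Y. reading_le y x} = ?A \<union> ?B"
      using Pair False by (auto simp: reading_le_def first_column_iff image_iff)
    moreover have "card (?A \<union> ?B) = card ?A + card ?B"
      by (rule card_Un_disjoint) (auto intro: finite_subset[OF _ finite_skew])
    moreover have "card ?A = length \<alpha> - length \<beta>"
      by (simp add: card_image inj_on_def)
    ultimately show ?thesis
      using assms Pair False by (simp add: S0_def)
  qed
qed

lemma S0_SIT: "S0 \<alpha> \<beta> \<in> SIT \<alpha> \<beta>"
proof -
  let ?rk = "\<lambda>x. card {y \<in> Y. reading_le y x}"
  have "bij_betw ?rk Y {1..N}"
    unfolding card_skew[symmetric]
    by (rule bij_betw_rank[OF finite_skew reading_le_refl reading_le_trans reading_le_antisym
        reading_le_total])
  then have "bij_betw (S0 \<alpha> \<beta>) Y {1..N}"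
    by (simp add: S0_eq_rank cong: bij_betw_cong)
  moreover have rk: "?rk x < ?rk y" if "x \<in> Y" "y \<in> Y" "reading_le x y" "x \<noteq> y" for x y
    by (rule rank_less[OF finite_skew reading_le_refl reading_le_trans reading_le_antisym
        reading_le_total that])
  moreover have "S0 \<alpha> \<beta> x < S0 \<alpha> \<beta> y" if "x \<in> Y" "y \<in> Y" "cell_prec x y" for x y
  proof -
    have "reading_le x y" and "x \<noteq> y"
      using cell_prec_reading_le[OF that(3)] by auto
    then have "?rk x < ?rk y"
      by (rule rk[OF that(1,2)])
    then show ?thesis
      using that by (simp add: S0_eq_rank)
  qed
  ultimately show ?thesis
    by (simp add: SIT_iff S0_def)
qed

text \<open>If every step from an entry to its successor follows the total reading order, then by
  transitivity the entries and the reading order sort the cells alike. So \<open>T x\<close> is the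
  rank of \<open>x\<close>, which is its entry in \<open>S0\<close>.\<close>

lemma SIT_eq_S0I:
  assumes T: "T \<in> SIT \<alpha> \<beta>"
    and succ: "\<And>x y. x \<in> Y \<Longrightarrow> y \<in> Y \<Longrightarrow> T y = Suc (T x) \<Longrightarrow> reading_le x y"
  shows "T = S0 \<alpha> \<beta>"
proof (rule extensionalityI)
  show "T \<in> extensional Y" and "S0 \<alpha> \<beta> \<in> extensional Y"
    using T S0_SIT by (auto simp: SIT_iff)
  fix x assume x: "x \<in> Y"
  \<comment> \<open>Induction on the difference of the entries: the cell holding the last
    intermediate entry exists because \<open>T\<close> is onto \<open>{1..N}\<close>.\<close>
  have le: "reading_le u v" if "u \<in> Y" "v \<in> Y" "T v = T u + d" for u v d
    using that
  proof (induction d arbitrary: v)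
    case 0
    then show ?case
      using SIT_inj[OF T, of u v] by (simp add: reading_le_refl)
  next
    case (Suc d)
    have "T u + d \<in> {1..N}"
      using SIT_range[OF T \<open>u \<in> Y\<close>] SIT_range[OF T \<open>v \<in> Y\<close>] Suc.prems(3) by auto
    then obtain t where "t \<in> Y" "T t = T u + d"
      using SIT_cell[OF T] by metis
    then show ?case
      using Suc.IH[of t] Suc.prems succ[of t v] by (auto intro: reading_le_trans)
  qed
  have "{y \<in> Y. reading_le y x} = {y \<in> Y. T y \<le> T x}"
  proof -
    have "reading_le y x \<longleftrightarrow> T y \<le> T x" if y: "y \<in> Y" for y
    proof
      assume "T y \<le> T x"
      then show "reading_le y x"
        using le[of y x "T x - T y"] x y by simp
    next
      assume rd: "reading_le y x"
      show "T y \<le> T x"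
      proof (rule ccontr)
        assume "\<not> T y \<le> T x"
        then have "reading_le x y"
          using le[of x y "T y - T x"] x y by simp
        then have "x = y"
          using rd by (rule reading_le_antisym)
        then show False
          using \<open>\<not> T y \<le> T x\<close> by simp
      qed
    qed
    then show ?thesis
      by blast
  qed
  \<comment> \<open>Entries start at 1 without gaps, so exactly \<open>T x\<close> cells have an
    entry at most \<open>T x\<close>.\<close>
  moreover have "T ` {y \<in> Y. T y \<le> T x} = {1..T x}"
    using T x SIT_range[OF T] SIT_cell[OF T]
    by (auto simp: image_iff) (metis SIT_range[OF T] atLeastAtMost_iff le_trans)
  moreover have "inj_on T {y \<in> Y. T y \<le> T x}"
    using SIT_inj[OF T] by (auto intro: inj_onI)
  ultimately have "card {y \<in> Y. reading_le y x} = T x"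
    by (metis card_image card_atLeastAtMost diff_Suc_1)
  then show "T x = S0 \<alpha> \<beta> x"
    using x by (simp add: S0_eq_rank)
qed

text \<open>Some consecutive entries at \<open>x\<close>, \<open>y\<close> violate the reading
  order. As \<open>cell_prec y x\<close> is excluded by the entries, \<open>y\<close> cannot lie
  below \<open>x\<close> in the first column or to its left in the same row. The remaining
  configurations put \<open>y\<close> strictly higher, with not both cells in the first column, so
  \<open>x\<close> and \<open>y\<close> may be exchanged.\<close>

lemma exists_ascent:
  assumes T: "T \<in> SIT \<alpha> \<beta>" and "T \<noteq> S0 \<alpha> \<beta>"
  obtains x y where "x \<in> Y" "y \<in> Y" "T y = Suc (T x)" "fst x < fst y" "\<not> cell_prec x y"
proof -
  obtain x y where xy: "x \<in> Y" "y \<in> Y" "T y = Suc (T x)" and nle: "\<not> reading_le x y"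
    using SIT_eq_S0I[OF T] assms(2) by blast
  have nprec: "\<not> cell_prec y x"
    using SIT_less[OF T xy(2,1)] xy(3) by auto
  have "fst x < fst y \<and> \<not> cell_prec x y"
  proof (cases "snd y = 0")
    case True
    show ?thesis
    proof (cases "snd x = 0")
      case True
      then show ?thesis
        using nle nprec \<open>snd y = 0\<close> by (auto simp: reading_le_def cell_prec_def)
    next
      case False
      have y: "y = (fst y, 0)"
        using True by (simp add: prod_eq_iff)
      \<comment> \<open>Otherwise the row of \<open>x\<close> is at or above that of
        \<open>y\<close>, hence above all rows of \<open>\<beta>\<close>, and its first cell is
        still present. Column and row conditions then give
        \<open>T y \<le> T (fst x, 0) < T x\<close>, contradicting
        \<open>T y = Suc (T x)\<close>.\<close>
      have "fst x < fst y"
      proof (rule ccontr)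
        assume "\<not> fst x < fst y"
        moreover from y xy(2) have "length \<beta> \<le> fst y"
          by (metis first_column_iff)
        ultimately have u: "(fst x, 0) \<in> Y"
          by (intro row_start xy) simp
        have "T (fst x, 0) < T x"
          using False by (intro SIT_less[OF T u xy(1)]) (simp add: cell_prec_def)
        moreover have "T y \<le> T (fst x, 0)"
        proof (cases "fst y = fst x")
          case True
          then show ?thesis
            using y by simp
        next
          case False
          then have "cell_prec y (fst x, 0)"
            using \<open>\<not> fst x < fst y\<close> \<open>snd y = 0\<close> by (simp add: cell_prec_def)
          then show ?thesis
            using SIT_less[OF T xy(2) u] by simp
        qed
        ultimately show False
          using xy(3) by simp
      qed
      then show ?thesis
        using False by (simp add: cell_prec_def)
    qed
  next
    case False
    then show ?thesis
      using nle nprec by (auto simp: reading_le_def cell_prec_def)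
  qed
  then show ?thesis
    using that xy by blast
qed

section \<open>Exchanging consecutive entries\<close>

lemma switch_apply: "x \<in> Y \<Longrightarrow> switch \<alpha> \<beta> i T x = Transposition.transpose i (Suc i) (T x)"
  by (simp add: switch_def)

lemma switch_switch:
  assumes "T \<in> SIT \<alpha> \<beta>"
  shows "switch \<alpha> \<beta> i (switch \<alpha> \<beta> i T) = T"
proof (rule extensionalityI)
  show "T \<in> extensional Y"
    using assms by (simp add: SIT_iff)
qed (auto simp: switch_def)

text \<open>Exchanging consecutive values reverses no comparison of entries except the one between
  the two cells that hold them, so only a constraint between \<open>x\<close> and \<open>y\<close>
  can break.\<close>

lemma switch_SIT_iff:
  assumes T: "T \<in> SIT \<alpha> \<beta>" and x: "x \<in> Y" and y: "y \<in> Y" and succ: "T y = Suc (T x)"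
  shows "switch \<alpha> \<beta> (T x) T \<in> SIT \<alpha> \<beta> \<longleftrightarrow> \<not> cell_prec x y"
proof
  assume "switch \<alpha> \<beta> (T x) T \<in> SIT \<alpha> \<beta>"
  then show "\<not> cell_prec x y"
    using SIT_less[OF _ x y, of "switch \<alpha> \<beta> (T x) T"] x y succ by (auto simp: switch_apply)
next
  assume nprec: "\<not> cell_prec x y"
  let ?t = "Transposition.transpose (T x) (Suc (T x))"
  have "T x \<in> {1..N}" and "Suc (T x) \<in> {1..N}"
    using SIT_range[OF T x] SIT_range[OF T y] succ by auto
  then have "bij_betw ?t {1..N} {1..N}"
    by (intro bij_betw_imageI) (auto intro: inj_on_transpose)
  then have "bij_betw (?t \<circ> T) Y {1..N}"
    using T by (intro bij_betw_trans[of T]) (auto simp: SIT_iff)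
  then have "bij_betw (switch \<alpha> \<beta> (T x) T) Y {1..N}"
    by (simp add: switch_def cong: bij_betw_cong)
  moreover have "?t (T u) < ?t (T v)" if uv: "u \<in> Y" "v \<in> Y" "cell_prec u v" for u v
  proof -
    have "T u < T v"
      by (rule SIT_less[OF T uv])
    moreover have "\<not> (T u = T x \<and> T v = Suc (T x))"
      using SIT_inj[OF T] uv x y succ nprec by metis
    ultimately show ?thesis
      by (auto simp: Transposition.transpose_def)
  qed
  ultimately show "switch \<alpha> \<beta> (T x) T \<in> SIT \<alpha> \<beta>"
    by (simp add: SIT_iff switch_def)
qed

definition weight :: "tableau \<Rightarrow> nat" where
  "weight T = (\<Sum>x\<in>Y. T x * fst x)"

text \<open>The larger entry moves down to the row of \<open>x\<close>, so the weight drops by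
  exactly \<open>fst y - fst x\<close>.\<close>

lemma weight_switch_less:
  assumes T: "T \<in> SIT \<alpha> \<beta>" and x: "x \<in> Y" and y: "y \<in> Y" and succ: "T y = Suc (T x)"
    and row: "fst x < fst y"
  shows "weight (switch \<alpha> \<beta> (T x) T) < weight T"
proof -
  have xy: "x \<noteq> y"
    using row by auto
  have split: "weight U = U x * fst x + (U y * fst y + (\<Sum>u\<in>Y - {x} - {y}. U u * fst u))" for U
    unfolding weight_def
    using x y xy by (simp add: finite_skew sum.remove[of Y x] sum.remove[of "Y - {x}" y])
  have "(\<Sum>u\<in>Y - {x} - {y}. switch \<alpha> \<beta> (T x) T u * fst u) = (\<Sum>u\<in>Y - {x} - {y}. T u * fst u)"
  proof (rule sum.cong[OF refl])
    fix u assume u: "u \<in> Y - {x} - {y}"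
    then have "T u \<noteq> T x" "T u \<noteq> T y"
      using SIT_inj[OF T] x y by blast+
    then show "switch \<alpha> \<beta> (T x) T u * fst u = T u * fst u"
      using u succ by (simp add: switch_apply)
  qed
  then show ?thesis
    unfolding split using row x y succ by (simp add: switch_apply)
qed

end

section \<open>The action of words and of the free algebra\<close>

lemma pi_op_zero [simp]: "pi_op D \<alpha> \<beta> i (\<lambda>U. 0) = (\<lambda>U. 0)"
  by (simp add: pi_op_def)

lemma pi_op_add: "pi_op D \<alpha> \<beta> i (\<lambda>U. u U + v U) = (\<lambda>U. pi_op D \<alpha> \<beta> i u U + pi_op D \<alpha> \<beta> i v U)"
  by (simp add: pi_op_def distrib_right sum.distrib)

lemma pi_op_sum:
  "pi_op D \<alpha> \<beta> i (\<lambda>U. \<Sum>a\<in>A. c a * f a U) = (\<lambda>U. \<Sum>a\<in>A. c a * pi_op D \<alpha> \<beta> i (f a) U)"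
proof
  fix U
  have "(\<Sum>T\<in>SIT \<alpha> \<beta>. (\<Sum>a\<in>A. c a * f a T) * pi_basis D \<alpha> \<beta> i T U) =
      (\<Sum>T\<in>SIT \<alpha> \<beta>. \<Sum>a\<in>A. c a * (f a T * pi_basis D \<alpha> \<beta> i T U))"
    by (simp add: sum_distrib_right mult.assoc)
  also have "\<dots> = (\<Sum>a\<in>A. \<Sum>T\<in>SIT \<alpha> \<beta>. c a * (f a T * pi_basis D \<alpha> \<beta> i T U))"
    by (rule sum.swap)
  finally show "pi_op D \<alpha> \<beta> i (\<lambda>U. \<Sum>a\<in>A. c a * f a U) U = (\<Sum>a\<in>A. c a * pi_op D \<alpha> \<beta> i (f a) U)"
    by (simp add: pi_op_def sum_distrib_left)
qed

lemma word_act_add: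
  "foldr (pi_op D \<alpha> \<beta>) w (\<lambda>U. u U + v U) =
    (\<lambda>U. foldr (pi_op D \<alpha> \<beta>) w u U + foldr (pi_op D \<alpha> \<beta>) w v U)"
  by (induction w) (simp_all add: pi_op_add)

lemma word_act_sum:
  "foldr (pi_op D \<alpha> \<beta>) w (\<lambda>U. \<Sum>a\<in>A. c a * f a U) =
    (\<lambda>U. \<Sum>a\<in>A. c a * foldr (pi_op D \<alpha> \<beta>) w (f a) U)"
  by (induction w) (simp_all add: pi_op_sum)

text \<open>Replacing the support by a larger finite set allows several elements to be summed over
  one index set.\<close>

lemma free_act_superset:
  assumes "finite W" and "{w. p w \<noteq> 0} \<subseteq> W"
  shows "free_act D \<alpha> \<beta> p v = (\<lambda>U. \<Sum>w\<in>W. p w * foldr (pi_op D \<alpha> \<beta>) w v U)"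
  unfolding free_act_def by (intro ext sum.mono_neutral_left) (use assms in auto)

lemma free_act_plus:
  assumes "p \<in> carrier (free_alg N)" and "q \<in> carrier (free_alg N)"
  shows "free_act D \<alpha> \<beta> (p \<oplus>\<^bsub>free_alg N\<^esub> q) v =
    (\<lambda>U. free_act D \<alpha> \<beta> p v U + free_act D \<alpha> \<beta> q v U)"
proof -
  let ?W = "{w. p w \<noteq> 0} \<union> {w. q w \<noteq> 0}"
  have fin: "finite ?W"
    using assms by (simp add: free_alg_simps(1))
  show ?thesis
    unfolding free_alg_simps(5)
    by (subst (1 2 3) free_act_superset[OF fin]) (auto simp: distrib_right sum.distrib)
qed

lemma free_act_minus:
  assumes "p \<in> carrier (free_alg N)" and "q \<in> carrier (free_alg N)"
  shows "free_act D \<alpha> \<beta> (p \<ominus>\<^bsub>free_alg N\<^esub> q) v =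
    (\<lambda>U. free_act D \<alpha> \<beta> p v U - free_act D \<alpha> \<beta> q v U)"
proof -
  interpret ring "free_alg N" by (rule ring_free_alg)
  have "free_act D \<alpha> \<beta> (\<ominus>\<^bsub>free_alg N\<^esub> q) v = (\<lambda>U. - free_act D \<alpha> \<beta> q v U)"
    by (simp add: free_uminus[OF assms(2)] free_act_def sum_negf)
  then show ?thesis
    using assms by (simp add: a_minus_def free_act_plus)
qed

text \<open>\<open>foldr\<close> over \<open>u @ w\<close> applies \<open>w\<close> first and then
  \<open>u\<close>, so concatenation of words is composition of operators; the rest is
  bilinearity.\<close>

lemma free_act_mult:
  assumes "p \<in> carrier (free_alg N)" and "q \<in> carrier (free_alg N)"
  shows "free_act D \<alpha> \<beta> (p \<otimes>\<^bsub>free_alg N\<^esub> q) v = free_act D \<alpha> \<beta> p (free_act D \<alpha> \<beta> q v)"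
proof
  fix U
  have fin: "finite {w. p w \<noteq> 0}" "finite {w. q w \<noteq> 0}"
    using assms by (simp_all add: free_alg_simps(1))
  have "free_act D \<alpha> \<beta> (p \<otimes>\<^bsub>free_alg N\<^esub> q) v U =
      (\<Sum>u | p u \<noteq> 0. \<Sum>w | q w \<noteq> 0. p u * (q w * foldr (pi_op D \<alpha> \<beta>) (u @ w) v U))"
    unfolding free_alg_simps(2) free_act_def by (rule free_mult_sum[OF fin])
  also have "\<dots> = free_act D \<alpha> \<beta> p (free_act D \<alpha> \<beta> q v) U"
    unfolding free_act_def word_act_sum by (simp add: sum_distrib_left)
  finally show "free_act D \<alpha> \<beta> (p \<otimes>\<^bsub>free_alg N\<^esub> q) v U = \<dots>" .
qed

lemma free_act_one: "free_act D \<alpha> \<beta> \<one>\<^bsub>free_alg N\<^esub> v = v"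
  by (subst free_act_superset[of "{[]}"]) (auto simp: free_alg_simps(3))

lemma free_act_letter: "free_act D \<alpha> \<beta> (letter i) v = pi_op D \<alpha> \<beta> i v"
  by (subst free_act_superset[of "{[i]}"]) (auto simp: letter_def)

lemma free_act_zero: "free_act D \<alpha> \<beta> \<zero>\<^bsub>free_alg N\<^esub> v = (\<lambda>U. 0)"
  by (simp add: free_act_def free_alg_simps(4))

lemma free_act_zero_vector: "free_act D \<alpha> \<beta> p (\<lambda>U. 0) = (\<lambda>U. 0)"
proof -
  have "foldr (pi_op D \<alpha> \<beta>) w (\<lambda>U. 0) = (\<lambda>U. 0)" for w
    by (induction w) simp_all
  then show ?thesis
    by (simp add: free_act_def)
qed

lemma free_act_add:
  "free_act D \<alpha> \<beta> p (\<lambda>U. u U + v U) = (\<lambda>U. free_act D \<alpha> \<beta> p u U + free_act D \<alpha> \<beta> p v U)"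
  by (simp add: free_act_def word_act_add distrib_left sum.distrib)

section \<open>The space spanned by the tableaux and its basis\<close>

definition tspace :: "nat list \<Rightarrow> nat list \<Rightarrow> tvector set" where
  "tspace \<alpha> \<beta> = {v. \<forall>T. T \<notin> SIT \<alpha> \<beta> \<longrightarrow> v T = 0}"

lemma tspace_expand:
  assumes "v \<in> tspace \<alpha> \<beta>"
  shows "v = (\<lambda>U. \<Sum>T\<in>SIT \<alpha> \<beta>. v T * tvec T U)"
proof
  fix U
  have "(\<Sum>T\<in>SIT \<alpha> \<beta>. v T * tvec T U) = (\<Sum>T\<in>SIT \<alpha> \<beta>. if U = T then v T else 0)"
    by (rule sum.cong) (auto simp: tvec_def)
  also have "\<dots> = v U"
    using assms by (simp add: finite_SIT tspace_def)
  finally show "v U = (\<Sum>T\<in>SIT \<alpha> \<beta>. v T * tvec T U)" ..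
qed

lemma word_act_eqI:
  assumes "v \<in> tspace \<alpha> \<beta>"
    and "\<And>T. T \<in> SIT \<alpha> \<beta> \<Longrightarrow>
      foldr (pi_op D \<alpha> \<beta>) w (tvec T) = foldr (pi_op D \<alpha> \<beta>) w' (tvec T)"
  shows "foldr (pi_op D \<alpha> \<beta>) w v = foldr (pi_op D \<alpha> \<beta>) w' v"
  by (subst (1 2) tspace_expand[OF assms(1)]) (simp add: word_act_sum assms(2))

lemma pi_op_tvec:
  assumes "T \<in> SIT \<alpha> \<beta>"
  shows "pi_op D \<alpha> \<beta> i (tvec T) = pi_basis D \<alpha> \<beta> i T"
proof
  fix U
  have "pi_op D \<alpha> \<beta> i (tvec T) U = (\<Sum>S\<in>SIT \<alpha> \<beta>. if S = T then pi_basis D \<alpha> \<beta> i T U else 0)"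
    unfolding pi_op_def by (rule sum.cong) (auto simp: tvec_def)
  then show "pi_op D \<alpha> \<beta> i (tvec T) U = pi_basis D \<alpha> \<beta> i T U"
    using assms by (simp add: finite_SIT)
qed

text \<open>Only coefficients at elements of \<open>SIT\<close> enter the sum, so this holds for
  arbitrary \<open>v\<close>. In \<open>free_act_closed\<close> only the empty word then depends on
  the input vector.\<close>

lemma pi_op_closed: "pi_op D \<alpha> \<beta> i v \<in> tspace \<alpha> \<beta>"
  by (auto simp: tspace_def pi_op_def pi_basis_def tvec_def intro!: sum.neutral)

lemma free_act_closed:
  assumes "v \<in> tspace \<alpha> \<beta>"
  shows "free_act D \<alpha> \<beta> p v \<in> tspace \<alpha> \<beta>"
proof -
  have "foldr (pi_op D \<alpha> \<beta>) w v \<in> tspace \<alpha> \<beta>" for w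
    by (cases w) (simp_all add: assms pi_op_closed)
  then show ?thesis
    by (simp add: tspace_def free_act_def)
qed

section \<open>The 0-Hecke relations\<close>

text \<open>For distinct rows both actions sort the entries \<open>i\<close> and \<open>i + 1\<close>; they differ only in
  the flag \<open>z\<close>, which tells whether two entries in one row are annihilated or left alone.\<close>

locale tableau_action = skew_shape +
  fixes D :: "tableau \<Rightarrow> nat set" and z :: bool
  assumes descent: "\<And>T x y. T \<in> SIT \<alpha> \<beta> \<Longrightarrow> x \<in> Y \<Longrightarrow> y \<in> Y \<Longrightarrow> T y = Suc (T x) \<Longrightarrow>
    T x \<in> D T \<longleftrightarrow> fst y < fst x \<or> z \<and> fst y = fst x"
begin

abbreviation "op \<equiv> pi_op D \<alpha> \<beta>"

text \<open>In one row \<open>y\<close> lies to the right of \<open>x\<close>, so an exchange leaves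
  \<open>SIT\<close> and a descent is annihilated. If \<open>y\<close> is strictly lower,
  \<open>cell_prec x y\<close> fails and the exchange is allowed.\<close>

lemma op_tvec_cells:
  assumes T: "T \<in> SIT \<alpha> \<beta>" and x: "x \<in> Y" and y: "y \<in> Y" and succ: "T y = Suc (T x)"
  shows "op (T x) (tvec T) =
    (if fst x < fst y then tvec T else if fst y < fst x then tvec (switch \<alpha> \<beta> (T x) T)
     else if z then (\<lambda>U. 0) else tvec T)"
proof -
  have same_row: "cell_prec x y" if "fst x = fst y"
  proof -
    have "\<not> cell_prec y x"
      using SIT_less[OF T y x] succ by auto
    moreover have "x \<noteq> y"
      using succ by auto
    ultimately show ?thesis
      using that by (auto simp: cell_prec_def prod_eq_iff)
  qed
  have "\<not> cell_prec x y" if "fst y < fst x"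
    using that by (auto simp: cell_prec_def)
  then show ?thesis
    using descent[OF assms] switch_SIT_iff[OF assms] same_row
    by (auto simp: pi_op_tvec[OF T] pi_basis_def)
qed

text \<open>Indexing by entries rather than cells makes the case distinction of an operator depend
  on this function alone, and \<open>switch\<close> merely permutes its argument.\<close>

definition row :: "tableau \<Rightarrow> nat \<Rightarrow> nat" where
  "row T j = fst (inv_into Y T j)"

lemma row_eq: "T \<in> SIT \<alpha> \<beta> \<Longrightarrow> x \<in> Y \<Longrightarrow> row T (T x) = fst x"
  by (auto simp: row_def SIT_iff bij_betw_def inv_into_f_f)

lemma op_tvec:
  assumes T: "T \<in> SIT \<alpha> \<beta>" and i: "i \<in> {1..<N}"
  shows "op i (tvec T) =
    (if row T i < row T (Suc i) then tvec T
     else if row T (Suc i) < row T i then tvec (switch \<alpha> \<beta> i T)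
     else if z then (\<lambda>U. 0) else tvec T)"
proof -
  obtain x where x: "x \<in> Y" "T x = i"
    using SIT_cell[OF T, of i] i by auto
  obtain y where y: "y \<in> Y" "T y = Suc i"
    using SIT_cell[OF T, of "Suc i"] i by auto
  show ?thesis
    using op_tvec_cells[OF T x(1) y(1)] row_eq[OF T x(1)] row_eq[OF T y(1)] x y by simp
qed

lemma
  assumes T: "T \<in> SIT \<alpha> \<beta>" and i: "i \<in> {1..<N}" and less: "row T (Suc i) < row T i"
  shows switch_SIT: "switch \<alpha> \<beta> i T \<in> SIT \<alpha> \<beta>"
    and row_switch: "j \<in> {1..N} \<Longrightarrow> row (switch \<alpha> \<beta> i T) j = row T (Transposition.transpose i (Suc i) j)"
proof -
  obtain x where x: "x \<in> Y" "T x = i"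
    using SIT_cell[OF T, of i] i by auto
  obtain y where y: "y \<in> Y" "T y = Suc i"
    using SIT_cell[OF T, of "Suc i"] i by auto
  have "fst y < fst x"
    using less row_eq[OF T x(1)] row_eq[OF T y(1)] x y by simp
  then show S: "switch \<alpha> \<beta> i T \<in> SIT \<alpha> \<beta>"
    using switch_SIT_iff[OF T x(1) y(1)] x y by (auto simp: cell_prec_def)
  assume "j \<in> {1..N}"
  then obtain c where c: "c \<in> Y" "switch \<alpha> \<beta> i T c = j"
    using SIT_cell[OF S] by metis
  then have "T c = Transposition.transpose i (Suc i) j"
    by (auto simp: switch_apply)
  then show "row (switch \<alpha> \<beta> i T) j = row T (Transposition.transpose i (Suc i) j)"
    using row_eq[OF S c(1)] row_eq[OF T c(1)] c by simp
qed

text \<open>After an exchange \<open>i\<close> lies strictly below \<open>i + 1\<close>, and such a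
  tableau is fixed.\<close>

lemma op_idem:
  assumes "i \<in> {1..<N}" and "v \<in> tspace \<alpha> \<beta>"
  shows "op i (op i v) = op i v"
proof -
  have "foldr op [i, i] v = foldr op [i] v"
  proof (rule word_act_eqI[OF assms(2)])
    fix T assume "T \<in> SIT \<alpha> \<beta>"
    then show "foldr op [i, i] (tvec T) = foldr op [i] (tvec T)"
      using assms(1) by (simp add: op_tvec switch_SIT row_switch)
  qed
  then show ?thesis
    by simp
qed

lemma switch_braid:
  "switch \<alpha> \<beta> i (switch \<alpha> \<beta> (Suc i) (switch \<alpha> \<beta> i T)) =
    switch \<alpha> \<beta> (Suc i) (switch \<alpha> \<beta> i (switch \<alpha> \<beta> (Suc i) T))"
  by (auto simp: switch_def Transposition.transpose_def restrict_def fun_eq_iff)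

lemma switch_commute:
  assumes "2 \<le> \<bar>int i - int j\<bar>"
  shows "switch \<alpha> \<beta> i (switch \<alpha> \<beta> j T) = switch \<alpha> \<beta> j (switch \<alpha> \<beta> i T)"
  using assms by (auto simp: switch_def Transposition.transpose_def restrict_def fun_eq_iff)

text \<open>Both sides sort the rows of \<open>i\<close>, \<open>i + 1\<close>, \<open>i + 2\<close>
  by adjacent comparisons. If two of these rows coincide and \<open>z\<close> holds, the equal rows
  become adjacent at some stage and both sides vanish; otherwise equal rows are never exchanged. In
  the fully reversed case the two results agree by \<open>switch_braid\<close>.\<close>

lemma op_braid:
  assumes "i \<in> {1..<N}" and "Suc i \<in> {1..<N}" and "v \<in> tspace \<alpha> \<beta>"
  shows "op i (op (Suc i) (op i v)) = op (Suc i) (op i (op (Suc i) v))"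
proof -
  have "foldr op [i, Suc i, i] v = foldr op [Suc i, i, Suc i] v"
  proof (rule word_act_eqI[OF assms(3)])
    fix T assume T: "T \<in> SIT \<alpha> \<beta>"
    show "foldr op [i, Suc i, i] (tvec T) = foldr op [Suc i, i, Suc i] (tvec T)"
      using T assms(1,2)
      by (cases "row T i" "row T (Suc i)" rule: linorder_cases;
          cases "row T i" "row T (Suc (Suc i))" rule: linorder_cases;
          cases "row T (Suc i)" "row T (Suc (Suc i))" rule: linorder_cases)
        (simp_all add: op_tvec switch_SIT row_switch switch_braid Transposition.transpose_def)
  qed
  then show ?thesis
    by simp
qed

text \<open>The two operators compare and exchange disjoint pairs of entries, so neither affects the
  case that applies to the other.\<close>

lemma op_commute:
  assumes "i \<in> {1..<N}" and "j \<in> {1..<N}" and ij: "2 \<le> \<bar>int i - int j\<bar>" and "v \<in> tspace \<alpha> \<beta>"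
  shows "op i (op j v) = op j (op i v)"
proof -
  have ne: "i \<noteq> j" "j \<noteq> i" "i \<noteq> Suc j" "Suc j \<noteq> i" "j \<noteq> Suc i" "Suc i \<noteq> j"
    using ij by auto
  have "foldr op [i, j] v = foldr op [j, i] v"
  proof (rule word_act_eqI[OF assms(4)])
    fix T assume T: "T \<in> SIT \<alpha> \<beta>"
    show "foldr op [i, j] (tvec T) = foldr op [j, i] (tvec T)"
      using T assms(1,2) ne
      by (cases "row T i" "row T (Suc i)" rule: linorder_cases;
          cases "row T j" "row T (Suc j)" rule: linorder_cases)
        (simp_all add: op_tvec switch_SIT row_switch switch_commute[OF ij] Transposition.transpose_def)
  qed
  then show ?thesis
    by simp
qed

section \<open>The annihilator ideal and the defining relations\<close>

definition annihilator :: "(nat list \<Rightarrow> complex) set" where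
  "annihilator = {p \<in> carrier (free_alg N). \<forall>v\<in>tspace \<alpha> \<beta>. free_act D \<alpha> \<beta> p v = (\<lambda>U. 0)}"

text \<open>The whole space is annihilated, not a single vector: right multiples vanish because
  \<open>free_act\<close> maps \<open>tspace\<close> into itself, left multiples because it fixes
  the zero vector.\<close>

lemma ideal_annihilator: "ideal annihilator (free_alg N)"
proof -
  interpret ring "free_alg N" by (rule ring_free_alg)
  show ?thesis
  proof (rule idealI)
    show "subgroup annihilator (add_monoid (free_alg N))"
    proof (rule add.subgroupI)
      show "annihilator \<noteq> {}"
        using zero_closed by (auto simp: annihilator_def free_act_zero)
      fix p assume p: "p \<in> annihilator"
      \<comment> \<open>Negation is written as zero minus \<open>p\<close>, so that
        \<open>free_act_minus\<close> applies.\<close>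
      then have "free_act D \<alpha> \<beta> (\<zero>\<^bsub>free_alg N\<^esub> \<ominus>\<^bsub>free_alg N\<^esub> p) v = (\<lambda>U. 0)"
        if "v \<in> tspace \<alpha> \<beta>" for v
        using that by (subst free_act_minus) (auto simp: annihilator_def free_act_zero)
      then show "\<ominus>\<^bsub>free_alg N\<^esub> p \<in> annihilator"
        using p by (simp add: annihilator_def a_minus_def)
    qed (auto simp: annihilator_def free_act_plus)
  qed (auto simp: annihilator_def ring_axioms free_act_mult free_act_closed free_act_zero_vector)
qed

text \<open>Each relator is a difference of two elements acting alike, hence lies in the
  annihilator; minimality of the generated ideal does the rest.\<close>

lemma Idl_hecke_rels: "Idl\<^bsub>free_alg N\<^esub> (hecke_rels N) \<subseteq> annihilator"
proof -
  interpret ring "free_alg N" by (rule ring_free_alg)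
  have minus: "p \<ominus>\<^bsub>free_alg N\<^esub> q \<in> annihilator"
    if "p \<in> carrier (free_alg N)" "q \<in> carrier (free_alg N)"
      "\<And>v. v \<in> tspace \<alpha> \<beta> \<Longrightarrow> free_act D \<alpha> \<beta> p v = free_act D \<alpha> \<beta> q v" for p q
    using that by (simp add: annihilator_def free_act_minus)
  have "hecke_rels N \<subseteq> annihilator"
    unfolding hecke_rels_def Let_def
    by (auto intro!: minus simp: letter_closed free_act_mult free_act_letter op_idem op_braid op_commute)
  then show ?thesis
    by (rule genideal_minimal[OF ideal_annihilator])
qed

section \<open>The tableau module\<close>

abbreviation "M \<equiv> tableau_module D \<alpha> \<beta>"

lemma tableau_module_simps:
  "carrier M = tspace \<alpha> \<beta>"
  "\<zero>\<^bsub>M\<^esub> = (\<lambda>T. 0)"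
  "u \<oplus>\<^bsub>M\<^esub> v = (\<lambda>T. u T + v T)"
  by (simp_all add: tableau_module_def tspace_def)

lemma carrier_hecke0:
  "carrier (hecke0 N) = (\<lambda>p. Idl\<^bsub>free_alg N\<^esub> (hecke_rels N) +>\<^bsub>free_alg N\<^esub> p) ` carrier (free_alg N)"
  unfolding hecke0_def FactRing_def A_RCOSETS_def' by auto

lemma hecke_carrierE:
  assumes "X \<in> carrier (hecke0 N)"
  obtains p where "p \<in> carrier (free_alg N)"
    and "X = Idl\<^bsub>free_alg N\<^esub> (hecke_rels N) +>\<^bsub>free_alg N\<^esub> p"
  using assms unfolding carrier_hecke0 by blast

text \<open>Representatives differ by elements of the annihilator, so the image of the coset is a
  singleton and \<open>the_elem\<close> returns its only member.\<close>

lemma coset_smult: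
  assumes p: "p \<in> carrier (free_alg N)" and v: "v \<in> tspace \<alpha> \<beta>"
  shows "(Idl\<^bsub>free_alg N\<^esub> (hecke_rels N) +>\<^bsub>free_alg N\<^esub> p) \<odot>\<^bsub>M\<^esub> v = free_act D \<alpha> \<beta> p v"
proof -
  interpret ring "free_alg N" by (rule ring_free_alg)
  let ?I = "Idl\<^bsub>free_alg N\<^esub> (hecke_rels N)"
  interpret I: ideal ?I "free_alg N"
    by (rule genideal_ideal[OF hecke_rels_closed])
  have "free_act D \<alpha> \<beta> (h \<oplus>\<^bsub>free_alg N\<^esub> p) v = free_act D \<alpha> \<beta> p v" if "h \<in> ?I" for h
  proof -
    have "h \<in> annihilator"
      using that Idl_hecke_rels by blast
    then show ?thesis
      using p v by (simp add: free_act_plus annihilator_def)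
  qed
  then have "\<And>q. q \<in> ?I +>\<^bsub>free_alg N\<^esub> p \<Longrightarrow> free_act D \<alpha> \<beta> q v = free_act D \<alpha> \<beta> p v"
    unfolding a_r_coset_def' by blast
  moreover have "p \<in> ?I +>\<^bsub>free_alg N\<^esub> p"
    by (rule I.a_rcos_self[OF p])
  ultimately have "(\<lambda>q. free_act D \<alpha> \<beta> q v) ` (?I +>\<^bsub>free_alg N\<^esub> p) = {free_act D \<alpha> \<beta> p v}"
    by blast
  then show ?thesis
    by (simp add: tableau_module_def)
qed

text \<open>Each axiom is checked on representatives, since sums and products of cosets are
  represented by sums and products in the free algebra.\<close>

lemma left_module_tableau: "left_module (hecke0 N) M"
proof -
  interpret F: ring "free_alg N" by (rule ring_free_alg)
  let ?I = "Idl\<^bsub>free_alg N\<^esub> (hecke_rels N)"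
  interpret I: ideal ?I "free_alg N"
    by (rule F.genideal_ideal[OF hecke_rels_closed])
  have add: "(?I +>\<^bsub>free_alg N\<^esub> p) \<oplus>\<^bsub>hecke0 N\<^esub> (?I +>\<^bsub>free_alg N\<^esub> q) = ?I +>\<^bsub>free_alg N\<^esub> (p \<oplus>\<^bsub>free_alg N\<^esub> q)"
    and mult: "(?I +>\<^bsub>free_alg N\<^esub> p) \<otimes>\<^bsub>hecke0 N\<^esub> (?I +>\<^bsub>free_alg N\<^esub> q) = ?I +>\<^bsub>free_alg N\<^esub> (p \<otimes>\<^bsub>free_alg N\<^esub> q)"
    if "p \<in> carrier (free_alg N)" "q \<in> carrier (free_alg N)" for p q
    using that by (simp_all add: hecke0_def FactRing_def I.a_rcos_sum I.rcoset_mult_add)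
  have one: "\<one>\<^bsub>hecke0 N\<^esub> = ?I +>\<^bsub>free_alg N\<^esub> \<one>\<^bsub>free_alg N\<^esub>"
    by (simp add: hecke0_def FactRing_def)
  have "ring (hecke0 N)"
    unfolding hecke0_def by (rule I.quotient_is_ring)
  moreover have "abelian_group M"
  proof (rule abelian_groupI)
    fix u assume "u \<in> carrier M"
    then show "\<exists>v\<in>carrier M. v \<oplus>\<^bsub>M\<^esub> u = \<zero>\<^bsub>M\<^esub>"
      by (intro bexI[of _ "\<lambda>T. - u T"]) (simp_all add: tableau_module_simps tspace_def)
  qed (simp_all add: tableau_module_simps tspace_def add_ac)
  moreover have "left_module_axioms (hecke0 N) M"
  proof
    fix X v assume "X \<in> carrier (hecke0 N)" and v: "v \<in> carrier M"
    then show "X \<odot>\<^bsub>M\<^esub> v \<in> carrier M"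
      by (elim hecke_carrierE) (simp add: coset_smult free_act_closed tableau_module_simps)
    fix u assume "u \<in> carrier M"
    then show "X \<odot>\<^bsub>M\<^esub> (v \<oplus>\<^bsub>M\<^esub> u) = X \<odot>\<^bsub>M\<^esub> v \<oplus>\<^bsub>M\<^esub> X \<odot>\<^bsub>M\<^esub> u"
      using \<open>X \<in> carrier (hecke0 N)\<close> v
      by (elim hecke_carrierE)
        (simp add: coset_smult free_act_add tableau_module_simps, simp add: coset_smult free_act_add tspace_def)
  next
    fix X X' v assume X: "X \<in> carrier (hecke0 N)" "X' \<in> carrier (hecke0 N)" and v: "v \<in> carrier M"
    from X(1) obtain p where p: "p \<in> carrier (free_alg N)" "X = ?I +>\<^bsub>free_alg N\<^esub> p"
      by (rule hecke_carrierE)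
    from X(2) obtain q where q: "q \<in> carrier (free_alg N)" "X' = ?I +>\<^bsub>free_alg N\<^esub> q"
      by (rule hecke_carrierE)
    show "(X \<oplus>\<^bsub>hecke0 N\<^esub> X') \<odot>\<^bsub>M\<^esub> v = X \<odot>\<^bsub>M\<^esub> v \<oplus>\<^bsub>M\<^esub> X' \<odot>\<^bsub>M\<^esub> v"
      using p q v by (simp add: add coset_smult free_act_plus tableau_module_simps)
    show "(X \<otimes>\<^bsub>hecke0 N\<^esub> X') \<odot>\<^bsub>M\<^esub> v = X \<odot>\<^bsub>M\<^esub> (X' \<odot>\<^bsub>M\<^esub> v)"
      using p q v by (simp add: mult coset_smult free_act_mult free_act_closed tableau_module_simps)
  next
    fix v assume "v \<in> carrier M"
    then show "\<one>\<^bsub>hecke0 N\<^esub> \<odot>\<^bsub>M\<^esub> v = v"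
      by (simp add: one coset_smult free_act_one tableau_module_simps)
  qed
  ultimately show ?thesis
    by (simp add: left_module_def)
qed

section \<open>Generation by \<open>S0\<close>\<close>

lemma tvec_reachable:
  assumes "T \<in> SIT \<alpha> \<beta>"
  shows "\<exists>w. set w \<subseteq> {1..<N} \<and> foldr op w (tvec (S0 \<alpha> \<beta>)) = tvec T"
  using assms
proof (induction T rule: measure_induct_rule[of weight])
  case (less T)
  show ?case
  proof (cases "T = S0 \<alpha> \<beta>")
    case True
    then show ?thesis
      by (intro exI[of _ "[]"]) simp
  next
    case False
    obtain x y where xy: "x \<in> Y" "y \<in> Y" "T y = Suc (T x)" "fst x < fst y" "\<not> cell_prec x y"
      using exists_ascent[OF less.prems False] .
    \<comment> \<open>\<open>S\<close> has smaller weight, so the induction hypothesis reaches it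
      from \<open>S0\<close>; one further generator has to lead from \<open>S\<close> to
      \<open>T\<close>.\<close>
    define S where "S = switch \<alpha> \<beta> (T x) T"
    have S: "S \<in> SIT \<alpha> \<beta>"
      unfolding S_def using switch_SIT_iff[OF less.prems xy(1-3)] xy(5) by simp
    have Sxy: "S y = T x" "S x = Suc (T x)"
      using xy by (simp_all add: S_def switch_apply)
    obtain w where w: "set w \<subseteq> {1..<N}" "foldr op w (tvec (S0 \<alpha> \<beta>)) = tvec S"
      using less.IH[OF _ S] weight_switch_less[OF less.prems xy(1-4)] by (auto simp: S_def)
    \<comment> \<open>In \<open>S\<close> the cells have changed roles: \<open>y\<close> holds
      \<open>T x\<close> and the strictly lower cell \<open>x\<close> holds its successor. The
      generator therefore exchanges them back.\<close>
    have "op (T x) (tvec S) = tvec (switch \<alpha> \<beta> (T x) S)"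
      using op_tvec_cells[OF S xy(2,1)] Sxy xy(4) by simp
    also have "switch \<alpha> \<beta> (T x) S = T"
      unfolding S_def by (rule switch_switch[OF less.prems])
    finally have "foldr op (T x # w) (tvec (S0 \<alpha> \<beta>)) = tvec T"
      using w by simp
    moreover have "T x \<in> {1..<N}"
      using SIT_range[OF less.prems xy(1)] SIT_range[OF less.prems xy(2)] xy(3) by simp
    ultimately show ?thesis
      using w(1) by (intro exI[of _ "T x # w"]) simp
  qed
qed

lemma tspace_generated:
  assumes v: "v \<in> tspace \<alpha> \<beta>"
  obtains p where "p \<in> carrier (free_alg N)" and "free_act D \<alpha> \<beta> p (tvec (S0 \<alpha> \<beta>)) = v"
proof -
  obtain wd where wd: "\<And>T. T \<in> SIT \<alpha> \<beta> \<Longrightarrow>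
      set (wd T) \<subseteq> {1..<N} \<and> foldr op (wd T) (tvec (S0 \<alpha> \<beta>)) = tvec T"
    using tvec_reachable by metis
  \<comment> \<open>A word determines the vector it produces from \<open>S0\<close>, and that vector
    determines its tableau. Hence the chosen words of distinct tableaux differ.\<close>
  have "tvec T = tvec T' \<Longrightarrow> T = T'" for T T'
    by (metis tvec_def zero_neq_one)
  then have inj: "inj_on wd (SIT \<alpha> \<beta>)"
    using wd by (metis inj_onI)
  let ?W = "wd ` SIT \<alpha> \<beta>"
  \<comment> \<open>By this injectivity the coefficient of \<open>T\<close> in \<open>v\<close> can
    be placed on the word \<open>wd T\<close> without collisions.\<close>
  define p where "p w = (if w \<in> ?W then v (inv_into (SIT \<alpha> \<beta>) wd w) else 0)" for w
  have supp: "{w. p w \<noteq> 0} \<subseteq> ?W"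
    by (auto simp: p_def)
  have fin: "finite ?W"
    by (simp add: finite_SIT)
  have "free_act D \<alpha> \<beta> p (tvec (S0 \<alpha> \<beta>)) =
      (\<lambda>U. \<Sum>T\<in>SIT \<alpha> \<beta>. p (wd T) * foldr op (wd T) (tvec (S0 \<alpha> \<beta>)) U)"
    by (simp add: free_act_superset[OF fin supp] sum.reindex[OF inj])
  also have "\<dots> = (\<lambda>U. \<Sum>T\<in>SIT \<alpha> \<beta>. v T * tvec T U)"
    by (intro ext sum.cong refl) (simp add: p_def wd inv_into_f_f[OF inj])
  also have "\<dots> = v"
    using tspace_expand[OF v] ..
  finally have "free_act D \<alpha> \<beta> p (tvec (S0 \<alpha> \<beta>)) = v" .
  moreover have "p \<in> carrier (free_alg N)"
    unfolding free_alg_simps(1) using finite_subset[OF supp fin] supp wd by blast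
  ultimately show ?thesis
    using that by blast
qed

theorem cyclic_tableau_module: "cyclic_module_generated_by (hecke0 N) M (tvec (S0 \<alpha> \<beta>))"
proof -
  have S0: "tvec (S0 \<alpha> \<beta>) \<in> tspace \<alpha> \<beta>"
    using S0_SIT by (auto simp: tspace_def tvec_def)
  interpret left_module "hecke0 N" M by (rule left_module_tableau)
  have "v \<in> {X \<odot>\<^bsub>M\<^esub> tvec (S0 \<alpha> \<beta>) | X. X \<in> carrier (hecke0 N)}" if v: "v \<in> tspace \<alpha> \<beta>" for v
  proof -
    obtain p where p: "p \<in> carrier (free_alg N)" "free_act D \<alpha> \<beta> p (tvec (S0 \<alpha> \<beta>)) = v"
      using tspace_generated[OF v] .
    let ?X = "Idl\<^bsub>free_alg N\<^esub> (hecke_rels N) +>\<^bsub>free_alg N\<^esub> p"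
    have "?X \<in> carrier (hecke0 N)"
      using p(1) by (simp add: carrier_hecke0)
    moreover have "v = ?X \<odot>\<^bsub>M\<^esub> tvec (S0 \<alpha> \<beta>)"
      by (simp add: coset_smult p S0)
    ultimately show ?thesis
      by blast
  qed
  moreover have "X \<odot>\<^bsub>M\<^esub> tvec (S0 \<alpha> \<beta>) \<in> tspace \<alpha> \<beta>" if "X \<in> carrier (hecke0 N)" for X
    using smult_closed[OF that] S0 by (simp add: tableau_module_simps)
  ultimately show ?thesis
    using S0 left_module_tableau
    by (auto simp: cyclic_module_generated_by_def tableau_module_simps(1))
qed

end

section \<open>The descent sets of the two actions\<close>

lemma (in skew_shape) Des_RS_iff:
  assumes T: "T \<in> SIT \<alpha> \<beta>" and xy: "x \<in> Y" "y \<in> Y" "T y = Suc (T x)"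
  shows "T x \<in> Des_RS \<alpha> \<beta> T \<longleftrightarrow> fst y \<le> fst x"
proof
  assume "T x \<in> Des_RS \<alpha> \<beta> T"
  then obtain u v where uv: "u \<in> Y" "v \<in> Y" "T u = T x" "T v = Suc (T x)" "fst v \<le> fst u"
    by (force simp: Des_RS_def)
  have "u = x" and "v = y"
    using SIT_inj[OF T] uv xy by metis+
  then show "fst y \<le> fst x"
    using uv(5) by simp
next
  assume "fst y \<le> fst x"
  then show "T x \<in> Des_RS \<alpha> \<beta> T"
    unfolding Des_RS_def using xy by (metis (mono_tags, lifting) mem_Collect_eq prod.collapse)
qed

lemma (in skew_shape) Des_A_iff:
  assumes T: "T \<in> SIT \<alpha> \<beta>" and xy: "x \<in> Y" "y \<in> Y" "T y = Suc (T x)"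
  shows "T x \<in> Des_A \<alpha> \<beta> T \<longleftrightarrow> fst y < fst x"
proof
  assume "T x \<in> Des_A \<alpha> \<beta> T"
  then obtain u v where uv: "u \<in> Y" "v \<in> Y" "T u = T x" "T v = Suc (T x)" "fst v < fst u"
    by (force simp: Des_A_def)
  have "u = x" and "v = y"
    using SIT_inj[OF T] uv xy by metis+
  then show "fst y < fst x"
    using uv(5) by simp
next
  assume "fst y < fst x"
  then show "T x \<in> Des_A \<alpha> \<beta> T"
    unfolding Des_A_def using xy by (metis (mono_tags, lifting) mem_Collect_eq prod.collapse)
qed

theorem theorem6p8:
  fixes \<alpha> \<beta> :: "nat list" and n m :: nat
  assumes "is_composition \<alpha> n" and "is_composition \<beta> m" and "comp_subset \<beta> \<alpha>"
  shows "cyclic_module_generated_by (hecke0 (n - m)) (V_module \<alpha> \<beta>) (tvec (S0 \<alpha> \<beta>)) \<and>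
         cyclic_module_generated_by (hecke0 (n - m)) (A_module \<alpha> \<beta>) (tvec (S0 \<alpha> \<beta>))"
proof -
  have n: "n = sum_list \<alpha>" and m: "m = sum_list \<beta>"
    using assms by (simp_all add: is_composition_def)
  interpret skew_shape \<alpha> \<beta>
    using assms by unfold_locales (auto simp: is_composition_def)
  \<comment> \<open>Entries \<open>i\<close>, \<open>i + 1\<close> in one row form a descent here
    and their exchange breaks the row condition, so they are annihilated and \<open>z\<close> is
    \<open>True\<close>. For \<open>Des_A\<close> they form no descent and the tableau is fixed, so
    \<open>z\<close> is \<open>False\<close>.\<close>
  interpret RS: tableau_action \<alpha> \<beta> "Des_RS \<alpha> \<beta>" True
  proof
    fix T x y assume *: "T \<in> SIT \<alpha> \<beta>" "x \<in> Y" "y \<in> Y" "T y = Suc (T x)"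
    then show "T x \<in> Des_RS \<alpha> \<beta> T \<longleftrightarrow> fst y < fst x \<or> True \<and> fst y = fst x"
      by (auto simp: Des_RS_iff)
  qed
  interpret A: tableau_action \<alpha> \<beta> "Des_A \<alpha> \<beta>" False
  proof
    fix T x y assume *: "T \<in> SIT \<alpha> \<beta>" "x \<in> Y" "y \<in> Y" "T y = Suc (T x)"
    then show "T x \<in> Des_A \<alpha> \<beta> T \<longleftrightarrow> fst y < fst x \<or> False \<and> fst y = fst x"
      by (simp add: Des_A_iff)
  qed
  show ?thesis
    using RS.cyclic_tableau_module A.cyclic_tableau_module
    unfolding n m V_module_def A_module_def by blast
qed

end
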